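(* Let $p$ be an odd prime, let $X$ denote the set of all odd positive integers, and let $Z_1,Z_2\subset X$ be the sets defined in the context. Fix any positive integer $N$, and write $\lambda:=\frac{2p-3}{2p-2}$. Then $$\frac{\#(Z_1\cap[0,N])}{\#(X\cap[0,N])}\ \ge\ 1-\frac1p-\frac1{p^3}-\frac1{p^5}-\left(\sum_{k\ge6\text{ even}}\frac{1}{p^{\lambda k}}\right)-\frac{\log_p(N)+1}{\lambda\,\#(X\cap[0,N])}$$ and $$\frac{\#(Z_2\cap[0,N])}{\#(X\cap[0,N])}\ \ge\ 1-\frac1p-\frac2{p^3}-\frac2{p^5}-\left(\sum_{k\ge6\text{ even}}\frac{2}{p^{\lambda k}}\right)-\frac{2\log_p(N)+2}{\lambda\,\#(X\cap[0,N])}.$$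
   Context: Define $B_0:=1$ and $B_j:=\frac{p^2B_{j-2}}{j}\in\mathbb{Q}$ for even $j\ge2$, and $b_j:=\nu_p(B_j)$, with $\nu_p$ the $p$-adic valuation. For an integer $n\ge1$ divisible by $p$, let $g(n)$ be the maximum even integer $j\geq 0$ with $b_j<\nu_p(n)$. Let $X_1\subset X$ be the set of odd positive integers divisible by $p$. Then $$Z_1:=X\setminus\bigcup_{n\in X_1}[n,n+g(n)],\qquad Z_2:=X\setminus\bigcup_{n\in X_1}[n-g(n),n+g(n)].$$ *)

theory Defs
  imports "HOL-Analysis.Infinite_Sum" "HOL-Computational_Algebra.Primes"
begin

text \<open>
  The \<open>p\<close>-adic valuation on the rationals, for nonzero arguments: \<open>quotient_of\<close> returns
  numerator and denominator in lowest terms. At \<open>0\<close>, where the valuation should be infinite,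
  this returns \<open>0\<close>; it is only ever applied to nonzero arguments below.
\<close>

definition padic_val :: "nat \<Rightarrow> rat \<Rightarrow> int" where
  "padic_val p x =
     int (multiplicity (int p) (fst (quotient_of x))) -
     int (multiplicity (int p) (snd (quotient_of x)))"

text \<open>Only the values of \<open>B p\<close> at even indices are meaningful; those at odd indices are a
  dummy \<open>0\<close>.\<close>

fun B :: "nat \<Rightarrow> nat \<Rightarrow> rat" where
  "B p 0 = 1"
| "B p (Suc 0) = 0"
| "B p (Suc (Suc j)) = (of_nat p)\<^sup>2 * B p j / of_nat (Suc (Suc j))"

definition b :: "nat \<Rightarrow> nat \<Rightarrow> int" where
  "b p j = padic_val p (B p j)"

text \<open>
  For an odd prime \<open>p\<close> and \<open>n \<ge> 1\<close> divisible by \<open>p\<close> the maximum exists: \<open>j = 0\<close> qualifies,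
  and \<open>b p j\<close> tends to infinity along even \<open>j\<close>. For other \<open>n\<close> the value is irrelevant.
\<close>

definition g :: "nat \<Rightarrow> int \<Rightarrow> nat" where
  "g p n = (GREATEST j. even j \<and> b p j < padic_val p (of_int n))"

definition X :: "int set" where
  "X = {n. n > 0 \<and> odd n}"

definition X1 :: "nat \<Rightarrow> int set" where
  "X1 p = {n \<in> X. int p dvd n}"

definition Z1 :: "nat \<Rightarrow> int set" where
  "Z1 p = X - (\<Union>n\<in>X1 p. {n..n + int (g p n)})"

definition Z2 :: "nat \<Rightarrow> int set" where
  "Z2 p = X - (\<Union>n\<in>X1 p. {n - int (g p n)..n + int (g p n)})"

end

theory Submission
  imports Defs
begin

text \<open>
  For even \<open>j\<close> the recursion gives \<open>B p j = p ^ j / (2 ^ (j div 2) * fact (j div 2))\<close>, so by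
  Legendre's formula, for \<open>j > 0\<close>, \<open>b p j\<close> is \<open>j\<close> minus less than \<open>(j / 2) / (p - 1)\<close>, which says
  \<open>b p j > lam * j\<close> (\<open>b_greater\<close>). Hence a multiple \<open>n\<close> of \<open>p\<close> whose reach
  \<open>g p n\<close> is at least \<open>k > 0\<close> has \<open>p\<close>-adic valuation at least \<open>lam * k\<close>, and even at least 3 for
  \<open>k = 2\<close> and at least 5 for \<open>k = 4\<close> (\<open>reach_exponent_dvd\<close>).

  An odd integer that is removed from \<open>X\<close> is a multiple of \<open>p\<close>, or lies at some even distance
  \<open>k > 0\<close>, on a given side, from an \<open>n\<close> with reach at least \<open>k\<close>. Write \<open>C\<close> for the number of odd
  integers in \<open>[0,N]\<close>, so that \<open>N \<le> 2 * C\<close>. Odd multiples of an odd \<open>M\<close> are spaced by \<open>2 * M\<close>, so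
  a window of length \<open>N\<close> holds at most \<open>N / (2 * M) + 1 \<le> C / M + 1\<close> of them. With
  \<open>M = p ^ v\<close>, where \<open>v\<close> is 3, 5 or at least \<open>lam * k\<close>, the terms \<open>C / M\<close> stay below \<open>C\<close> times the densities
  in the claim.

  It remains to sum the rounding errors 1, which occur only for the distances that are realised
  in \<open>[0,N]\<close>. There \<open>p ^ v \<le> n \<le> N + k\<close>, while \<open>k \<le> 4 / 3 * v\<close> is at most half of
  \<open>p ^ v\<close>; this forces \<open>lam * k \<le> log p N + 1\<close> (\<open>covered_at_nonempty_imp\<close>). There are at
  most \<open>(log p N + 1) / (2 * lam)\<close> such even \<open>k\<close>. That is half of the error allowed for each side,
  and the other half absorbs the rounding error \<open>1 / 2\<close> for the multiples of \<open>p\<close>.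
\<close>

section \<open>The valuations of the coefficients\<close>

text \<open>
  The recursive form of Legendre's formula: \<open>n div p\<close> of the factors of \<open>n!\<close> are multiples of \<open>p\<close>,
  and dividing each of them by \<open>p\<close> leaves \<open>(n div p)!\<close>.
\<close>

lemma multiplicity_fact_div:
  fixes p n :: nat
  assumes "prime p"
  shows "multiplicity (int p) (fact n :: int) =
           n div p + multiplicity (int p) (fact (n div p) :: int)"
proof (induction n)
  case 0
  show ?case by simp
next
  case (Suc n)
  have prime: "prime_elem (int p)" using assms by simp
  have fact_Suc_mult: "multiplicity (int p) (fact (Suc m) :: int)
      = multiplicity (int p) (int (Suc m)) + multiplicity (int p) (fact m :: int)" for m
    unfolding fact_Suc by (rule prime_elem_multiplicity_mult_distrib[OF prime]) auto
  show ?case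
  proof (cases "p dvd Suc n")
    case True
    then obtain q where q: "Suc n = p * q" by blast
    then have "q > 0" by (metis bot_nat_0.not_eq_extremum mult_0_right nat.distinct(1))
    have "p > 0" using assms prime_gt_0_nat by blast
    have div: "Suc n div p = q" unfolding q using \<open>p > 0\<close> by simp
    have "Suc (n div p) = q"
      using div True by (simp add: div_Suc dvd_eq_mod_eq_0)
    have "multiplicity (int p) (int (Suc n)) = 1 + multiplicity (int p) (int q)"
      unfolding q of_nat_mult
      by (subst prime_elem_multiplicity_mult_distrib[OF prime])
         (use \<open>q > 0\<close> \<open>p > 0\<close> prime in auto)
    then show ?thesis
      using fact_Suc_mult[of n] fact_Suc_mult[of "n div p"] Suc.IH \<open>Suc (n div p) = q\<close> div
      by simp
  next
    case False
    then have "\<not> int p dvd int (Suc n)" by (simp only: int_dvd_int_iff not_False_eq_True)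
    then have "multiplicity (int p) (int (Suc n)) = 0"
      by (rule not_dvd_imp_multiplicity_0)
    moreover have "Suc n div p = n div p"
      using False by (simp add: div_Suc dvd_eq_mod_eq_0)
    ultimately show ?thesis using fact_Suc_mult[of n] Suc.IH by simp
  qed
qed

lemma multiplicity_fact_less:
  fixes p n :: nat
  assumes "prime p" and "n > 0"
  shows "(p - 1) * multiplicity (int p) (fact n :: int) < n"
  using \<open>n > 0\<close>
proof (induction n rule: less_induct)
  case (less n)
  have p: "p \<ge> 2" using assms(1) prime_ge_2_nat by blast
  let ?q = "n div p"
  show ?case
  proof (cases "?q = 0")
    case True
    then show ?thesis using multiplicity_fact_div[OF assms(1), of n] less.prems by simp
  next
    case False
    have "?q < n" using p less.prems by simp
    then have "(p - 1) * multiplicity (int p) (fact ?q :: int) < ?q"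
      using less.IH False by blast
    then have "(p - 1) * multiplicity (int p) (fact n :: int) < (p - 1) * ?q + ?q"
      unfolding multiplicity_fact_div[OF assms(1), of n] by (simp add: distrib_left)
    also have "\<dots> = p * ?q" using p by (cases p) auto
    also have "\<dots> \<le> n" by simp
    finally show ?thesis .
  qed
qed

lemma padic_val_of_int: "padic_val p (of_int n) = int (multiplicity (int p) n)"
  unfolding padic_val_def by (simp add: quotient_of_int)

lemma padic_val_quotient:
  fixes a d :: int
  assumes "prime p" and "x * of_int d = of_int a" and "a \<noteq> 0" and "d \<noteq> 0"
  shows "padic_val p x = int (multiplicity (int p) a) - int (multiplicity (int p) d)"
proof -
  obtain u w where uw: "quotient_of x = (u, w)" by force
  have w: "w > 0" using quotient_of_denom_pos[OF uw] .
  have x: "x = of_int u / of_int w" using quotient_of_div[OF uw] .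
  have "(of_int (u * d) :: rat) = of_int (a * w)"
    using assms(2) x w by (simp add: field_simps)
  then have eq: "u * d = a * w" by (simp only: of_int_eq_iff)
  then have "u \<noteq> 0" using assms w by auto
  have prime: "prime_elem (int p)" using assms by simp
  have "multiplicity (int p) (u * d) = multiplicity (int p) (a * w)" using eq by simp
  then have "multiplicity (int p) u + multiplicity (int p) d
      = multiplicity (int p) a + multiplicity (int p) w"
    using prime_elem_multiplicity_mult_distrib[OF prime, of u d]
      prime_elem_multiplicity_mult_distrib[OF prime, of a w] \<open>u \<noteq> 0\<close> assms w by simp
  then show ?thesis unfolding padic_val_def uw by simp
qed

lemma B_even: "B p (2 * m) * of_int (2 ^ m * fact m) = of_int (int p ^ (2 * m))"
proof (induction m)
  case 0
  show ?case by simp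
next
  case (Suc m)
  have "B p (2 * Suc m) * of_int (2 ^ Suc m * fact (Suc m))
      = (of_nat p)\<^sup>2 * (B p (2 * m) * of_int (2 ^ m * fact m))"
    by (simp add: field_simps)
  then show ?case unfolding Suc.IH by (simp add: power2_eq_square)
qed

lemma b_even:
  assumes "prime p" and "odd p"
  shows "b p (2 * m) = 2 * int m - int (multiplicity (int p) (fact m :: int))"
proof -
  have prime: "prime_elem (int p)" using assms by simp
  have "\<not> int p dvd 2"
  proof
    assume "int p dvd 2"
    then have "p dvd 2" by (metis int_dvd_int_iff of_nat_numeral)
    then have "p = 2" using assms(1) primes_dvd_imp_eq two_is_prime_nat by blast
    then show False using assms(2) by simp
  qed
  then have "multiplicity (int p) (2 ^ m) = 0"
    using prime not_dvd_imp_multiplicity_0 prime_elem_dvd_power by blast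
  then have "multiplicity (int p) (2 ^ m * fact m :: int)
      = multiplicity (int p) (fact m :: int)"
    by (subst prime_elem_multiplicity_mult_distrib[OF prime]) auto
  moreover have "multiplicity (int p) (int p ^ (2 * m)) = 2 * m"
    using prime multiplicity_prime_power by blast
  moreover have "p \<noteq> 0" using assms by auto
  ultimately show ?thesis
    unfolding b_def using padic_val_quotient[OF assms(1) B_even[of p m]] by simp
qed

text \<open>
  By \<open>multiplicity_fact_less\<close> the factorial costs less than \<open>(j / 2) / (p - 1)\<close> of the valuation
  \<open>j\<close>, and \<open>lam\<close> is exactly \<open>1 - 1 / (2 * (p - 1))\<close>. The strictness is what gives
  \<open>b p 4 \<ge> 4\<close> at \<open>p = 3\<close>, where \<open>lam * 4 = 3\<close>.
\<close>

lemma b_greater: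
  fixes lam :: real
  assumes "prime p" and "odd p" and lam: "lam = (2 * real p - 3) / (2 * real p - 2)"
    and "even j" and "j > 0"
  shows "lam * real j < of_int (b p j)"
proof -
  obtain m where j: "j = 2 * m" using \<open>even j\<close> by blast
  then have "m > 0" using \<open>j > 0\<close> by simp
  have p: "p \<ge> 2" using assms(1) prime_ge_2_nat by blast
  let ?v = "multiplicity (int p) (fact m :: int)"
  have "real ((p - 1) * ?v) < real m"
    using multiplicity_fact_less[OF assms(1) \<open>m > 0\<close>] by (simp only: of_nat_less_iff)
  then have "(real p - 1) * real ?v < real m" using p by (simp add: of_nat_diff)
  then have "lam * real j < 2 * real m - real ?v"
    unfolding lam j using p by (simp add: field_simps)
  then show ?thesis unfolding j b_even[OF assms(1,2)] by simp
qed

lemma lam_bounds: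
  fixes lam :: real
  assumes "prime p" and "odd p" and lam: "lam = (2 * real p - 3) / (2 * real p - 2)"
  shows "3 / 4 \<le> lam" and "lam < 1"
proof -
  have "p \<noteq> 2" using assms(2) by auto
  then have "p \<ge> 3" using prime_ge_2_nat[OF assms(1)] by simp
  then show "3 / 4 \<le> lam" "lam < 1" unfolding lam by (auto simp: field_simps)
qed

text \<open>
  The maximum in the definition of \<open>g\<close> is attained: \<open>b p j > lam * j \<ge> 3 / 4 * j\<close> bounds the
  candidates \<open>j > 0\<close> by twice the valuation of \<open>n\<close>, and \<open>j = 0\<close> is one of them.
\<close>

lemma g_maximal:
  fixes n :: int
  assumes "prime p" and "odd p" and "n > 0" and "int p dvd n"
  shows "even (g p n)" and "b p (g p n) < int (multiplicity (int p) n)"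
proof -
  define P where "P j \<longleftrightarrow> even j \<and> b p j < padic_val p (of_int n)" for j
  let ?v = "multiplicity (int p) n"
  define lam where "lam = (2 * real p - 3) / (2 * real p - 2)"
  have lam: "3 / 4 \<le> lam" using lam_bounds[OF assms(1,2) lam_def] by blast
  have "?v > 0"
    using assms by (subst prime_multiplicity_gt_zero_iff) auto
  moreover have "b p 0 = 0" using b_even[OF assms(1,2), of 0] by simp
  ultimately have "P 0" unfolding P_def padic_val_of_int by simp
  moreover have "j \<le> 2 * ?v" if "P j" for j
  proof (cases "j = 0")
    case False
    have "lam * real j < of_int (b p j)"
      using b_greater[OF assms(1,2) lam_def, of j] that False unfolding P_def by simp
    moreover have "b p j < int ?v" using that unfolding P_def padic_val_of_int by simp
    moreover have "3 / 4 * real j \<le> lam * real j" using lam by (intro mult_right_mono) auto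
    ultimately have "real j \<le> real (2 * ?v)" by simp
    then show ?thesis by (simp only: of_nat_le_iff)
  qed simp
  ultimately have "P (Greatest P)" using GreatestI_nat[of P 0 "2 * ?v"] by blast
  moreover have "g p n = Greatest P" unfolding g_def P_def ..
  ultimately show "even (g p n)" "b p (g p n) < int ?v"
    unfolding P_def padic_val_of_int by auto
qed

text \<open>
  The exponent of a power of \<open>p\<close> that divides every \<open>n\<close> with \<open>g p n \<ge> k\<close>, for even \<open>k > 0\<close>. The
  values at 2 and 4 are \<open>b p k + 1\<close>; from 6 on \<open>lam * k\<close> serves as a lower bound for it.
\<close>

definition reach_exponent :: "real \<Rightarrow> nat \<Rightarrow> nat" where
  "reach_exponent lam k = (if k = 2 then 3 else if k = 4 then 5 else nat \<lceil>lam * real k\<rceil>)"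

lemma reach_exponent_ge:
  assumes "lam < 1"
  shows "lam * real k \<le> real (reach_exponent lam k)"
  using assms unfolding reach_exponent_def by (auto simp: real_nat_ceiling_ge)

text \<open>
  Since \<open>b p\<close> is not monotone (\<open>b p j - b p (j - 2)\<close> is 2 minus the valuation of \<open>j\<close>), a reach of
  at least \<open>k\<close> does not put the valuation of \<open>n\<close> above \<open>b p k\<close> directly. The comparison goes
  through the linear lower bound, which is monotone, at the index \<open>g p n \<ge> k\<close>.
\<close>

lemma reach_exponent_dvd:
  fixes lam :: real and n :: int
  assumes "prime p" and "odd p" and lam: "lam = (2 * real p - 3) / (2 * real p - 2)"
    and "n > 0" and "int p dvd n" and "even k" and "k > 0" and "k \<le> g p n"
  shows "int p ^ reach_exponent lam k dvd n"
proof (rule multiplicity_dvd')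
  let ?j = "g p n"
  note lam1 = lam_bounds[OF assms(1-3)]
  note j = g_maximal[OF assms(1,2,4,5)]
  have j0: "?j > 0" using assms by simp
  have bj: "lam * real ?j < of_int (b p ?j)" using b_greater[OF assms(1-3) j(1) j0] .
  moreover have "lam * real k \<le> lam * real ?j" using assms(8) lam1 by (intro mult_left_mono) auto
  ultimately have "lam * real k < of_int (b p ?j)" by simp
  then have ceil: "\<lceil>lam * real k\<rceil> \<le> b p ?j" by linarith
  have lamj: "3 / 4 * real ?j \<le> lam * real ?j" using lam1 by (intro mult_right_mono) auto
  have "3 \<le> int (multiplicity (int p) n)" if "k = 2"
  proof -
    have "real ?j \<ge> 2" using assms that by simp
    then have "1 < real_of_int (b p ?j)" using bj lamj by linarith
    then show ?thesis using j(2) by linarith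
  qed
  moreover have "5 \<le> int (multiplicity (int p) n)" if "k = 4"
  proof -
    have "real ?j \<ge> 4" using assms that by simp
    then have "3 < real_of_int (b p ?j)" using bj lamj by linarith
    then show ?thesis using j(2) by linarith
  qed
  moreover have "nat \<lceil>lam * real k\<rceil> \<le> multiplicity (int p) n" using ceil j(2) by linarith
  ultimately show "reach_exponent lam k \<le> multiplicity (int p) n"
    unfolding reach_exponent_def by simp
qed

section \<open>Counting odd multiples\<close>

lemma card_odd_nonneg: "card (X \<inter> {0..int N}) = (N + 1) div 2"
proof -
  have "X \<inter> {0..int N} = (\<lambda>t. 2 * int t + 1) ` {0..<(N + 1) div 2}" (is "?L = ?R")
  proof
    show "?L \<subseteq> ?R"
    proof
      fix x assume x: "x \<in> ?L"
      then obtain t where t: "x = 2 * t + 1" unfolding X_def by (auto elim: oddE)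
      have "t \<ge> 0" using x t unfolding X_def by auto
      then have "x = 2 * int (nat t) + 1" "nat t \<in> {0..<(N + 1) div 2}" using t x by auto
      then show "x \<in> ?R" by blast
    qed
    show "?R \<subseteq> ?L" unfolding X_def by auto
  qed
  moreover have "inj_on (\<lambda>t. 2 * int t + 1) {0..<(N + 1) div 2}" by (auto intro: inj_onI)
  ultimately show ?thesis by (simp add: card_image)
qed

lemma card_le_card_of_image:
  assumes "S \<subseteq> f ` T" and "finite T"
  shows "card S \<le> card T"
  using assms surj_card_le by blast

text \<open>
  An odd multiple of \<open>M\<close> has the form \<open>M * (2 * t + 1)\<close>, so a window of length \<open>N\<close> confines
  \<open>t\<close> to a half-open interval of length \<open>N / (2 * M)\<close>.
\<close>

lemma card_odd_multiples_window:
  fixes M c :: int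
  assumes "M > 0"
  shows "real (card {n \<in> {c<..c + int N}. odd n \<and> M dvd n})
           \<le> real N / (2 * of_int M) + 1"
proof -
  define lo hi where "lo = (of_int c / of_int M - 1) / (2::real)"
    and "hi = (of_int (c + int N) / of_int M - 1) / (2::real)"
  have "{n \<in> {c<..c + int N}. odd n \<and> M dvd n}
      \<subseteq> (\<lambda>t. M * (2 * t + 1)) ` {\<lfloor>lo\<rfloor><..\<lfloor>hi\<rfloor>}"
  proof
    fix n assume n: "n \<in> {n \<in> {c<..c + int N}. odd n \<and> M dvd n}"
    then obtain u where u: "n = M * u" by auto
    then have "odd u" using n by auto
    then obtain t where t: "u = 2 * t + 1" by (auto elim: oddE)
    have "real_of_int c < of_int (M * (2 * t + 1))"
      "of_int (M * (2 * t + 1)) \<le> real_of_int (c + int N)"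
      using n u t by (auto simp only: of_int_less_iff of_int_le_iff mem_Collect_eq
          greaterThanAtMost_iff)
    then have "lo < of_int t" "of_int t \<le> hi"
      unfolding lo_def hi_def using assms by (simp_all add: field_simps)
    then have "t \<in> {\<lfloor>lo\<rfloor><..\<lfloor>hi\<rfloor>}" by (simp add: floor_less_iff le_floor_iff)
    then show "n \<in> (\<lambda>t. M * (2 * t + 1)) ` {\<lfloor>lo\<rfloor><..\<lfloor>hi\<rfloor>}" using u t by blast
  qed
  then have "card {n \<in> {c<..c + int N}. odd n \<and> M dvd n} \<le> card {\<lfloor>lo\<rfloor><..\<lfloor>hi\<rfloor>}"
    by (rule card_le_card_of_image) simp
  moreover have "lo \<le> hi" unfolding lo_def hi_def using assms by (simp add: field_simps)
  then have "\<lfloor>lo\<rfloor> \<le> \<lfloor>hi\<rfloor>" by (rule floor_mono)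
  then have "real (card {\<lfloor>lo\<rfloor><..\<lfloor>hi\<rfloor>}) \<le> hi - lo + 1" by simp linarith
  moreover have "hi - lo = real N / (2 * of_int M)"
    unfolding lo_def hi_def using assms by (simp add: field_simps)
  ultimately show ?thesis by linarith
qed

text \<open>
  The smallest positive number \<open>M * (2 * t + 1)\<close> is \<open>M\<close> itself, half a period after the start of
  the window, and this halves the rounding error.
\<close>

lemma card_odd_multiples_initial:
  fixes M :: int
  assumes "M > 0"
  shows "real (card {n \<in> {0<..int N}. odd n \<and> M dvd n})
           \<le> real N / (2 * of_int M) + 1 / 2"
proof -
  define hi where "hi = (real N / of_int M - 1) / (2::real)"
  have "{n \<in> {0<..int N}. odd n \<and> M dvd n} \<subseteq> (\<lambda>t. M * (2 * t + 1)) ` {0..\<lfloor>hi\<rfloor>}"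
  proof
    fix n assume n: "n \<in> {n \<in> {0<..int N}. odd n \<and> M dvd n}"
    then obtain u where u: "n = M * u" by auto
    then have "odd u" using n by auto
    then obtain t where t: "u = 2 * t + 1" by (auto elim: oddE)
    have "0 < M * (2 * t + 1)" using n u t by auto
    then have "t \<ge> 0" using assms by (simp add: zero_less_mult_iff)
    have "real_of_int (M * (2 * t + 1)) \<le> real_of_int (int N)"
      using n u t by (auto simp only: of_int_le_iff mem_Collect_eq greaterThanAtMost_iff)
    then have "of_int t \<le> hi" unfolding hi_def using assms by (simp add: field_simps)
    then have "t \<in> {0..\<lfloor>hi\<rfloor>}" using \<open>t \<ge> 0\<close> by (simp add: le_floor_iff)
    then show "n \<in> (\<lambda>t. M * (2 * t + 1)) ` {0..\<lfloor>hi\<rfloor>}" using u t by blast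
  qed
  then have "card {n \<in> {0<..int N}. odd n \<and> M dvd n} \<le> card {0..\<lfloor>hi\<rfloor>}"
    by (rule card_le_card_of_image) simp
  moreover have "hi \<ge> - 1 / 2" unfolding hi_def using assms by (simp add: field_simps)
  then have "real (card {0..\<lfloor>hi\<rfloor>}) \<le> hi + 1" by simp linarith
  moreover have "hi + 1 = real N / (2 * of_int M) + 1 / 2"
    unfolding hi_def using assms by (simp add: field_simps)
  ultimately show ?thesis by linarith
qed


section \<open>Integers covered at a fixed distance\<close>

text \<open>The sign \<open>s\<close> is the side of \<open>n\<close> on which the covered integer lies.\<close>

definition covered_at :: "nat \<Rightarrow> int \<Rightarrow> nat \<Rightarrow> int set" where
  "covered_at p s k = {x \<in> X. \<exists>n \<in> X1 p. k \<le> g p n \<and> x = n + s * int k}"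

text \<open>
  Translating by \<open>- s * k\<close> turns the covered integers in \<open>{1..N}\<close> into odd multiples of
  \<open>p ^ reach_exponent lam k\<close> in another window of length \<open>N\<close>.
\<close>

lemma card_covered_at:
  fixes lam :: real
  assumes "prime p" and "odd p" and lam: "lam = (2 * real p - 3) / (2 * real p - 2)"
    and "even k" and "k > 0"
  shows "real (card (covered_at p s k \<inter> {0..int N}))
           \<le> real (card (X \<inter> {0..int N})) / real p ^ reach_exponent lam k + 1"
proof -
  define M where "M = int p ^ reach_exponent lam k"
  have "M > 0" unfolding M_def using prime_gt_0_nat[OF assms(1)] by simp
  define W where "W = {n \<in> {- (s * int k)<..- (s * int k) + int N}. odd n \<and> M dvd n}"
  have "covered_at p s k \<inter> {0..int N} \<subseteq> (\<lambda>n. n + s * int k) ` W"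
  proof
    fix x assume x: "x \<in> covered_at p s k \<inter> {0..int N}"
    then obtain n where n: "n \<in> X1 p" "k \<le> g p n" "x = n + s * int k" "x \<in> X"
      unfolding covered_at_def by blast
    have "M dvd n"
      unfolding M_def using n reach_exponent_dvd[OF assms(1-3) _ _ assms(4,5)]
      by (simp add: X1_def X_def)
    then have "n \<in> W" using n x unfolding W_def X1_def X_def by auto
    then show "x \<in> (\<lambda>n. n + s * int k) ` W" using n by blast
  qed
  moreover have "finite W"
    by (rule finite_subset[of _ "{- (s * int k)<..- (s * int k) + int N}"]) (auto simp: W_def)
  ultimately have "card (covered_at p s k \<inter> {0..int N}) \<le> card W"
    by (rule card_le_card_of_image)
  moreover have "real (card W) \<le> real N / (2 * of_int M) + 1"
    unfolding W_def by (rule card_odd_multiples_window[OF \<open>M > 0\<close>])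
  moreover have "real N / 2 \<le> real (card (X \<inter> {0..int N}))"
    unfolding card_odd_nonneg by linarith
  then have "real N / 2 / of_int M \<le> real (card (X \<inter> {0..int N})) / of_int M"
    using \<open>M > 0\<close> by (intro divide_right_mono) auto
  moreover have "of_int M = real p ^ reach_exponent lam k" unfolding M_def by simp
  ultimately show ?thesis by simp
qed

text \<open>
  On the left side (\<open>s = - 1\<close>) the covering \<open>n\<close> may exceed \<open>N\<close>, but by at most \<open>k\<close>. Since
  \<open>v = reach_exponent lam k\<close> is at least \<open>3 / 4 * k\<close>, there is a chain
  \<open>2 * k \<le> 3 * v \<le> 3 ^ v \<le> p ^ v\<close>; so \<open>p ^ v \<le> N + k\<close> implies \<open>p ^ v \<le> 2 * N \<le> p * N\<close>.
\<close>

lemma covered_at_nonempty_imp: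
  fixes lam :: real
  assumes "prime p" and "odd p" and lam: "lam = (2 * real p - 3) / (2 * real p - 2)"
    and "even k" and "k > 0" and "s \<ge> - 1" and "N > 0"
    and x: "x \<in> covered_at p s k \<inter> {0..int N}"
  shows "lam * real k \<le> log (real p) (real N) + 1"
proof -
  define v where "v = reach_exponent lam k"
  note lam1 = lam_bounds[OF assms(1-3)]
  have "p \<noteq> 2" using assms(2) by auto
  then have p: "p \<ge> 3" using prime_ge_2_nat[OF assms(1)] by simp
  obtain n where n: "n \<in> X1 p" "k \<le> g p n" "x = n + s * int k"
    using x unfolding covered_at_def by blast
  have "int p ^ v dvd n"
    unfolding v_def using n reach_exponent_dvd[OF assms(1-3) _ _ assms(4,5)]
    by (simp add: X1_def X_def)
  then have "int p ^ v \<le> n" using n by (intro zdvd_imp_le) (auto simp: X1_def X_def)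
  moreover have "- 1 * int k \<le> s * int k" using assms(6) by (intro mult_right_mono) auto
  then have "n \<le> int N + int k" using x n by auto
  ultimately have "int p ^ v \<le> int N + int k" by simp
  then have pv: "real p ^ v \<le> real N + real k"
    by (metis (mono_tags) of_int_le_iff of_int_power of_int_of_nat_eq of_int_add)
  have v: "lam * real k \<le> real v" unfolding v_def using reach_exponent_ge lam1 by blast
  have "3 / 4 * real k \<le> lam * real k" using lam1 by (intro mult_right_mono) auto
  then have kv: "3 / 4 * real k \<le> real v" using v by simp
  have three_mult_le_power: "3 * real m \<le> 3 ^ m" for m :: nat
  proof (induction m)
    case (Suc m)
    then show ?case by (cases "m = 0") (use Suc in auto)
  qed simp
  have "2 * real k \<le> 3 * real v" using kv by simp
  also have "\<dots> \<le> 3 ^ v" by (rule three_mult_le_power)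
  also have "\<dots> \<le> real p ^ v" using p by (intro power_mono) auto
  finally have "real p ^ v \<le> 2 * real N" using pv by simp
  also have "\<dots> \<le> real p * real N" using p by (intro mult_right_mono) auto
  finally have "real p powr real v \<le> real p * real N" using p by (simp add: powr_realpow)
  then have "real v \<le> log (real p) (real p * real N)"
    using p \<open>N > 0\<close> by (subst le_log_iff) auto
  also have "\<dots> = log (real p) (real N) + 1"
    using p \<open>N > 0\<close> by (simp add: log_mult)
  finally show ?thesis using v by simp
qed

section \<open>Adding up the distances\<close>

lemma card_even_le:
  fixes r :: real
  assumes "r \<ge> 0"
  shows "finite {k::nat. even k \<and> k > 0 \<and> real k \<le> r}"
    and "real (card {k::nat. even k \<and> k > 0 \<and> real k \<le> r}) \<le> r / 2"
proof -
  have sub: "{k::nat. even k \<and> k > 0 \<and> real k \<le> r} \<subseteq> (\<lambda>m. 2 * m) ` {0<..nat \<lfloor>r / 2\<rfloor>}"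
  proof
    fix k :: nat assume k: "k \<in> {k::nat. even k \<and> k > 0 \<and> real k \<le> r}"
    then obtain m where m: "k = 2 * m" by blast
    then have "real m \<le> r / 2" using k by simp
    then have "m \<in> {0<..nat \<lfloor>r / 2\<rfloor>}" using k m by (auto simp: le_nat_floor)
    then show "k \<in> (\<lambda>m. 2 * m) ` {0<..nat \<lfloor>r / 2\<rfloor>}" using m by blast
  qed
  then show "finite {k::nat. even k \<and> k > 0 \<and> real k \<le> r}"
    by (rule finite_subset) auto
  have "card {k::nat. even k \<and> k > 0 \<and> real k \<le> r} \<le> card {0<..nat \<lfloor>r / 2\<rfloor>}"
    using sub by (rule card_le_card_of_image) simp
  then show "real (card {k::nat. even k \<and> k > 0 \<and> real k \<le> r}) \<le> r / 2"
    using assms by simp linarith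
qed

lemma summable_powr_tail:
  fixes p lam :: real
  assumes "p > 1" and "lam > 0"
  shows "(\<lambda>k. 1 / p powr (lam * real k)) summable_on A"
proof -
  define q where "q = p powr (- lam)"
  have q: "0 < q" "q < 1" unfolding q_def using assms by (auto simp: powr_less_one)
  have "summable (\<lambda>k. q ^ k)" using q by (intro summable_geometric) auto
  then have "(\<lambda>k. q ^ k) summable_on UNIV"
    by (rule summable_nonneg_imp_summable_on) (use q in auto)
  moreover have "q ^ k = 1 / p powr (lam * real k)" for k
    unfolding q_def using assms by (simp add: powr_powr flip: powr_realpow powr_minus_divide)
  ultimately have "(\<lambda>k. 1 / p powr (lam * real k)) summable_on UNIV" by simp
  then show ?thesis by (rule summable_on_subset_banach) simp
qed

lemma sum_reach_density_le:
  fixes lam :: real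
  assumes "p \<ge> 2" and "lam > 0" and "lam < 1" and "finite K"
    and K: "\<And>k. k \<in> K \<Longrightarrow> even k \<and> k > 0"
  shows "(\<Sum>k\<in>K. 1 / real p ^ reach_exponent lam k)
           \<le> 1 / real p ^ 3 + 1 / real p ^ 5
             + (\<Sum>\<^sub>\<infinity>k\<in>{k::nat. k \<ge> 6 \<and> even k}. 1 / real p powr (lam * real k))"
proof -
  let ?f = "\<lambda>k. 1 / real p ^ reach_exponent lam k"
  let ?h = "\<lambda>k. 1 / real p powr (lam * real k)"
  let ?T = "{k::nat. k \<ge> 6 \<and> even k}"
  have "k \<ge> 6" if "k \<in> K - {2, 4}" for k
  proof (rule ccontr)
    assume "\<not> k \<ge> 6"
    then have "k \<in> {0, 1, 2, 3, 4, 5}" by auto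
    then show False using K[of k] that by auto
  qed
  then have T: "K - {2, 4} \<subseteq> ?T" using K by auto
  have "sum ?f K \<le> sum ?f ({2, 4} \<union> (K - {2, 4}))"
    using assms by (intro sum_mono2) auto
  also have "\<dots> = 1 / real p ^ 3 + 1 / real p ^ 5 + sum ?f (K - {2, 4})"
    using \<open>finite K\<close> by (subst sum.union_disjoint) (auto simp: reach_exponent_def)
  also have "sum ?f (K - {2, 4}) \<le> sum ?h (K - {2, 4})"
  proof (rule sum_mono)
    fix k
    have "real p powr (lam * real k) \<le> real p powr real (reach_exponent lam k)"
      using assms reach_exponent_ge[of lam k] by (intro powr_mono) auto
    also have "\<dots> = real p ^ reach_exponent lam k" using assms by (simp add: powr_realpow)
    finally show "?f k \<le> ?h k" using assms by (intro divide_left_mono) auto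
  qed
  also have "sum ?h (K - {2, 4}) \<le> infsum ?h ?T"
    using assms T by (intro finite_sum_le_infsum summable_powr_tail) auto
  finally show ?thesis by simp
qed

text \<open>
  Both bounds at once: \<open>S\<close> is the set of sides on which the integers are covered, and each side
  contributes the same density \<open>D\<close> and the same error \<open>L / lam\<close>.
\<close>

lemma uncovered_density_ge:
  fixes p N :: nat and lam :: real and S :: "int set"
  defines "C \<equiv> real (card (X \<inter> {0..int N}))"
    and "D \<equiv> 1 / real p ^ 3 + 1 / real p ^ 5
           + (\<Sum>\<^sub>\<infinity>k\<in>{k::nat. k \<ge> 6 \<and> even k}. 1 / real p powr (lam * real k))"
    and "L \<equiv> log (real p) (real N) + 1"
  assumes "prime p" and "odd p" and "N > 0"
    and lam: "lam = (2 * real p - 3) / (2 * real p - 2)"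
    and S: "finite S" "S \<noteq> {}" "\<And>s. s \<in> S \<Longrightarrow> s \<ge> - 1"
    and Y: "Y \<subseteq> X"
      "X - Y \<subseteq> X1 p \<union> (\<Union>s\<in>S. \<Union>k\<in>{k. even k \<and> k > 0}. covered_at p s k)"
  shows "1 - 1 / real p - real (card S) * D - real (card S) * L / (lam * C)
           \<le> real (card (Y \<inter> {0..int N})) / C"
proof -
  note lam1 = lam_bounds[OF assms(4,5) lam]
  have p: "p \<ge> 2" using prime_ge_2_nat[OF \<open>prime p\<close>] .
  define A where "A s k = covered_at p s k \<inter> {0..int N}" for s k
  define K where "K = {k::nat. even k \<and> k > 0 \<and> real k \<le> L / lam}"
  have "log (real p) (real N) \<ge> 0" using p \<open>N > 0\<close> by simp
  then have L: "L \<ge> 1" unfolding L_def by simp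
  then have "L / lam \<ge> 0" using lam1 by simp
  note K_card = card_even_le[OF this, folded K_def]
  have C: "C \<ge> 1" unfolding C_def card_odd_nonneg using \<open>N > 0\<close> by simp
  have N_le: "real N / 2 \<le> C" unfolding C_def card_odd_nonneg by linarith
  have fin: "finite (A s k)" for s k unfolding A_def by simp

  let ?U = "\<Union>s\<in>S. \<Union>k\<in>K. A s k"
  have far: "real (card ?U) \<le> real (card S) * (C * D + L / (2 * lam))"
  proof -
    have "real (card ?U) \<le> real (\<Sum>s\<in>S. card (\<Union>k\<in>K. A s k))"
      using card_UN_le[OF S(1), of "\<lambda>s. \<Union>k\<in>K. A s k"] by (simp only: of_nat_le_iff)
    also have "\<dots> = (\<Sum>s\<in>S. real (card (\<Union>k\<in>K. A s k)))" by simp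
    also have "\<dots> \<le> (\<Sum>s\<in>S. C * D + L / (2 * lam))"
    proof (rule sum_mono)
      fix s
      have "real (card (\<Union>k\<in>K. A s k)) \<le> real (\<Sum>k\<in>K. card (A s k))"
        using card_UN_le[OF K_card(1), of "A s"] by (simp only: of_nat_le_iff)
      also have "\<dots> = (\<Sum>k\<in>K. real (card (A s k)))" by simp
      also have "\<dots> \<le> (\<Sum>k\<in>K. C * (1 / real p ^ reach_exponent lam k) + 1)"
        using card_covered_at[OF assms(4,5) lam, of _ s N]
        unfolding A_def C_def by (intro sum_mono) (auto simp: K_def)
      also have "\<dots> = C * (\<Sum>k\<in>K. 1 / real p ^ reach_exponent lam k) + real (card K)"
        by (simp add: sum.distrib sum_distrib_left)
      also have "\<dots> \<le> C * D + L / lam / 2"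
        unfolding D_def using p lam1 K_card C
        by (intro add_mono mult_left_mono sum_reach_density_le) (auto simp: K_def)
      finally show "real (card (\<Union>k\<in>K. A s k)) \<le> C * D + L / (2 * lam)" by simp
    qed
    also have "\<dots> = real (card S) * (C * D + L / (2 * lam))" by simp
    finally show ?thesis .
  qed

  let ?V = "{n \<in> {0<..int N}. odd n \<and> int p dvd n}"
  have "finite ?V" by (rule finite_subset[of _ "{0<..int N}"]) auto
  have "real (card ?V) \<le> real N / (2 * real p) + 1 / 2"
    using card_odd_multiples_initial[of "int p" N] p by simp
  also have "real N / (2 * real p) = real N / 2 / real p" by simp
  also have "\<dots> \<le> C / real p" using N_le by (intro divide_right_mono) auto
  finally have near: "real (card ?V) \<le> C / real p + 1 / 2" by simp

  have "X \<inter> {0..int N} \<subseteq> (Y \<inter> {0..int N}) \<union> (?V \<union> ?U)"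
  proof
    fix x assume x: "x \<in> X \<inter> {0..int N}"
    show "x \<in> (Y \<inter> {0..int N}) \<union> (?V \<union> ?U)"
    proof (cases "x \<in> Y \<or> x \<in> X1 p")
      case True
      then show ?thesis using x unfolding X1_def X_def by auto
    next
      case False
      then obtain s k where sk: "s \<in> S" "even k" "k > 0" "x \<in> covered_at p s k"
        using Y x by blast
      then have xA: "x \<in> covered_at p s k \<inter> {0..int N}" using x by simp
      have "lam * real k \<le> L" unfolding L_def
        by (rule covered_at_nonempty_imp[OF assms(4,5) lam sk(2,3) S(3)[OF sk(1)] assms(6) xA])
      then have "real k \<le> L / lam" using lam1 by (simp add: field_simps)
      then have "k \<in> K" using sk unfolding K_def by simp
      then show ?thesis using sk xA unfolding A_def by blast
    qed
  qed
  then have "card (X \<inter> {0..int N}) \<le> card ((Y \<inter> {0..int N}) \<union> (?V \<union> ?U))"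
    using fin S(1) K_card(1) \<open>finite ?V\<close> by (intro card_mono) auto
  also have "\<dots> \<le> card (Y \<inter> {0..int N}) + (card ?V + card ?U)"
    by (meson card_Un_le add_left_mono order_trans)
  finally have "C \<le> real (card (Y \<inter> {0..int N})) + (real (card ?V) + real (card ?U))"
    unfolding C_def by (simp only: of_nat_le_iff of_nat_add[symmetric])
  \<comment> \<open>The other half of the allowed error absorbs the rounding error for the multiples of \<open>p\<close>.\<close>
  moreover have "1 / 2 \<le> real (card S) * (L / (2 * lam))"
  proof -
    have "1 \<le> card S" using S by (simp add: Suc_le_eq card_gt_0_iff)
    then have "1 * (1 / 2) \<le> real (card S) * (L / (2 * lam))"
      using L lam1 by (intro mult_mono) (auto simp: field_simps)
    then show ?thesis by simp
  qed
  ultimately have "C - C / real p - real (card S) * (C * D) - real (card S) * L / lam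
      \<le> real (card (Y \<inter> {0..int N}))"
    using near far by (simp add: algebra_simps add_divide_distrib)
  then have "(C - C / real p - real (card S) * (C * D) - real (card S) * L / lam) / C
      \<le> real (card (Y \<inter> {0..int N})) / C"
    using C by (intro divide_right_mono) auto
  moreover have "(C - C / real p - real (card S) * (C * D) - real (card S) * L / lam) / C
      = 1 - 1 / real p - real (card S) * D - real (card S) * L / (lam * C)"
    using C lam1 p by (simp add: field_simps)
  ultimately show ?thesis by simp
qed

lemma covered_cases:
  assumes "x \<in> X" and "n \<in> X1 p" and "\<bar>x - n\<bar> \<le> int (g p n)"
  shows "x \<in> X1 p \<or> (\<exists>k. even k \<and> k > 0 \<and> x \<in> covered_at p (sgn (x - n)) k)"
proof (cases "x = n")
  case False
  have even: "even (nat \<bar>x - n\<bar>)" using assms unfolding X1_def X_def by (simp add: even_nat_iff)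
  have "x = n + sgn (x - n) * int (nat \<bar>x - n\<bar>)"
    by (simp add: sgn_mult_abs)
  moreover have "nat \<bar>x - n\<bar> \<le> g p n" using assms(3) by linarith
  ultimately have "x \<in> covered_at p (sgn (x - n)) (nat \<bar>x - n\<bar>)"
    unfolding covered_at_def using assms(1,2) by blast
  with even show ?thesis using False by (intro disjI2 exI[of _ "nat \<bar>x - n\<bar>"]) auto
qed (use assms in auto)

lemma Z1_uncovered:
  "X - Z1 p \<subseteq> X1 p \<union> (\<Union>s\<in>{1}. \<Union>k\<in>{k. even k \<and> k > 0}. covered_at p s k)"
proof
  fix x assume "x \<in> X - Z1 p"
  then obtain n where n: "x \<in> X" "n \<in> X1 p" "n \<le> x" "x \<le> n + int (g p n)"
    unfolding Z1_def by auto
  then have "\<bar>x - n\<bar> \<le> int (g p n)" "x \<in> X1 p \<or> sgn (x - n) \<in> {1}"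
    by (auto simp: sgn_if)
  then show "x \<in> X1 p \<union> (\<Union>s\<in>{1}. \<Union>k\<in>{k. even k \<and> k > 0}. covered_at p s k)"
    using covered_cases[OF n(1,2)] by blast
qed

lemma Z2_uncovered:
  "X - Z2 p \<subseteq> X1 p \<union> (\<Union>s\<in>{1, - 1}. \<Union>k\<in>{k. even k \<and> k > 0}. covered_at p s k)"
proof
  fix x assume "x \<in> X - Z2 p"
  then obtain n where n: "x \<in> X" "n \<in> X1 p" "n - int (g p n) \<le> x" "x \<le> n + int (g p n)"
    unfolding Z2_def by auto
  then have "\<bar>x - n\<bar> \<le> int (g p n)" "x \<in> X1 p \<or> sgn (x - n) \<in> {1, - 1}"
    by (auto simp: sgn_if)
  then show "x \<in> X1 p \<union> (\<Union>s\<in>{1, - 1}. \<Union>k\<in>{k. even k \<and> k > 0}. covered_at p s k)"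
    using covered_cases[OF n(1,2)] by blast
qed

theorem proposition6p2:
  fixes p N :: nat and lam :: real
  assumes "prime p" and "odd p" and "N > 0"
    and lam: "lam = (2 * real p - 3) / (2 * real p - 2)"
  shows
    "real (card (Z1 p \<inter> {0..int N})) / real (card (X \<inter> {0..int N})) \<ge>
       1 - 1 / real p - 1 / real p ^ 3 - 1 / real p ^ 5
         - (\<Sum>\<^sub>\<infinity>k\<in>{k::nat. k \<ge> 6 \<and> even k}. 1 / real p powr (lam * real k))
         - (log (real p) (real N) + 1) / (lam * real (card (X \<inter> {0..int N})))
     \<and>
     real (card (Z2 p \<inter> {0..int N})) / real (card (X \<inter> {0..int N})) \<ge>
       1 - 1 / real p - 2 / real p ^ 3 - 2 / real p ^ 5
         - (\<Sum>\<^sub>\<infinity>k\<in>{k::nat. k \<ge> 6 \<and> even k}. 2 / real p powr (lam * real k))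
         - (2 * log (real p) (real N) + 2) / (lam * real (card (X \<inter> {0..int N})))"
proof (rule conjI)
  let ?C = "real (card (X \<inter> {0..int N}))"
  let ?T = "{k::nat. k \<ge> 6 \<and> even k}"
  have cards: "real (card {1::int}) = 1" "real (card {1, - 1::int}) = 2" by auto
  have double: "(\<Sum>\<^sub>\<infinity>k\<in>?T. 2 / real p powr (lam * real k))
      = 2 * (\<Sum>\<^sub>\<infinity>k\<in>?T. 1 / real p powr (lam * real k))"
    using infsum_cmult_right'[of 2 "\<lambda>k. 1 / real p powr (lam * real k)" ?T] by simp
  have "Z1 p \<subseteq> X" "Z2 p \<subseteq> X" unfolding Z1_def Z2_def by auto
  show "real (card (Z1 p \<inter> {0..int N})) / ?C \<ge>
       1 - 1 / real p - 1 / real p ^ 3 - 1 / real p ^ 5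
         - (\<Sum>\<^sub>\<infinity>k\<in>?T. 1 / real p powr (lam * real k))
         - (log (real p) (real N) + 1) / (lam * ?C)"
    using uncovered_density_ge[OF assms, of "{1}", OF _ _ _ \<open>Z1 p \<subseteq> X\<close> Z1_uncovered]
    unfolding cards by simp
  show "real (card (Z2 p \<inter> {0..int N})) / ?C \<ge>
       1 - 1 / real p - 2 / real p ^ 3 - 2 / real p ^ 5
         - (\<Sum>\<^sub>\<infinity>k\<in>?T. 2 / real p powr (lam * real k))
         - (2 * log (real p) (real N) + 2) / (lam * ?C)"
  proof -
    have "s \<ge> - 1" if "s \<in> {1, - 1}" for s :: int using that by auto
    from uncovered_density_ge[OF assms _ _ this \<open>Z2 p \<subseteq> X\<close> Z2_uncovered]
    show ?thesis unfolding cards double by (simp add: algebra_simps)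
  qed
qed

end
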